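(* If $\lambda_t$, $t\in[0,T]$, is a normal extremal on the Cartan group, then there exist $0\le t_1<t_2<\dots<t_n\le T$ for which the following conditions hold: (a) $h_1h_2(\lambda_{t_i})=0$ for $i=1,\dots,n$; (b) for any $i=1,\dots,n-1$ one of the following conditions is satisfied: - $h_1h_2(\lambda_t)\neq0$ for all $t\in(t_i,t_{i+1})$, or - $h_1(\lambda_t)=0$ for all $t\in[t_i,t_{i+1}]$ and $h_2(\lambda_t)\ne0$ for all $t\in(t_i,t_{i+1})$, or - $h_2(\lambda_t)=0$ for all $t\in[t_i,t_{i+1}]$ and $h_1(\lambda_t)\ne0$ for all $t\in(t_i,t_{i+1})$.
   Context: Cartan group: $M=\mathbb{R}^5$ with coordinates $(x,y,z,v,w)$, the connected simply connected Lie group with left-invariant frame $X_1=\partial_x-\frac y2\partial_z-\frac{x^2+y^2}{2}\partial_w$, $X_2=\partial_y+\frac x2\partial_z+\frac{x^2+y^2}{2}\partial_v$, $X_3=\partial_z+x\partial_v+y\partial_w$, $X_4=\partial_v$, $X_5=\partial_w$, satisfying $[X_1,X_2]=X_3$, $[X_1,X_3]=X_4$, $[X_2,X_3]=X_5$, with $X_4,X_5$ central. A trajectory is an absolutely continuous curve $q:[0,T]\to M$ ($T>0$) with $\dot q=u_1X_1(q)+u_2X_2(q)$ for a.e. $t$, for a measurable control $u=(u_1,u_2)$ with $\max(|u_1(t)|,|u_2(t)|)\le 1$. For $\lambda\in T^*M$ put $h_i(\lambda)=\langle\lambda,X_i\rangle$, $i=1,\dots,5$. A normal extremal over a trajectory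 $q$ with control $u$ is a Lipschitz curve $\lambda_t\in T^*_{q(t)}M$ such that for a.e. $t$ (writing $h_i=h_i(\lambda_t)$) $\dot h_1=-u_2h_3$, $\dot h_2=u_1h_3$, $\dot h_3=u_1h_4+u_2h_5$, $\dot h_4=\dot h_5=0$, and $u_1h_1+u_2h_2=|h_1|+|h_2|=H$, where $H>0$ is constant. Here $h_1h_2(\lambda_t)$ denotes the product $h_1(\lambda_t)h_2(\lambda_t)$. *)

theory Defs
  imports "HOL-Analysis.Analysis"
begin

text \<open>
  The underlying manifold of the Cartan group is \<open>real ^ 5\<close>, with coordinates
  \<open>(x, y, z, v, w) = (q $ 1, q $ 2, q $ 3, q $ 4, q $ 5)\<close>.  A vector field is a function
  \<open>real ^ 5 \<Rightarrow> real ^ 5\<close>, and \<open>axis i 1\<close> is the \<open>i\<close>-th coordinate vector field.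
\<close>

definition X1 :: "real ^ 5 \<Rightarrow> real ^ 5" where
  "X1 q = axis 1 1 - (q $ 2 / 2) *\<^sub>R axis 3 1
        - (((q $ 1)\<^sup>2 + (q $ 2)\<^sup>2) / 2) *\<^sub>R axis 5 1"

definition X2 :: "real ^ 5 \<Rightarrow> real ^ 5" where
  "X2 q = axis 2 1 + (q $ 1 / 2) *\<^sub>R axis 3 1
        + (((q $ 1)\<^sup>2 + (q $ 2)\<^sup>2) / 2) *\<^sub>R axis 4 1"

definition X3 :: "real ^ 5 \<Rightarrow> real ^ 5" where
  "X3 q = axis 3 1 + (q $ 1) *\<^sub>R axis 4 1 + (q $ 2) *\<^sub>R axis 5 1"

definition X4 :: "real ^ 5 \<Rightarrow> real ^ 5" where
  "X4 q = axis 4 1"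

definition X5 :: "real ^ 5 \<Rightarrow> real ^ 5" where
  "X5 q = axis 5 1"

text \<open>
  The tangent bundle of \<open>real ^ 5\<close> is trivial, so a point of the cotangent bundle is a base
  point together with a linear functional on \<open>real ^ 5\<close>.
\<close>

type_synonym cotangent = "(real ^ 5) \<times> ((real ^ 5) \<Rightarrow>\<^sub>L real)"

definition pair_field :: "(real ^ 5 \<Rightarrow> real ^ 5) \<Rightarrow> cotangent \<Rightarrow> real" where
  "pair_field X \<xi> = blinfun_apply (snd \<xi>) (X (fst \<xi>))"

definition h1 :: "cotangent \<Rightarrow> real" where "h1 = pair_field X1"
definition h2 :: "cotangent \<Rightarrow> real" where "h2 = pair_field X2"
definition h3 :: "cotangent \<Rightarrow> real" where "h3 = pair_field X3"
definition h4 :: "cotangent \<Rightarrow> real" where "h4 = pair_field X4"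
definition h5 :: "cotangent \<Rightarrow> real" where "h5 = pair_field X5"

text \<open>
  Absolute continuity of a curve on \<open>{a..b}\<close>; a pair \<open>(c, d)\<close> in \<open>D\<close> stands for the
  interval with endpoints \<open>c \<le> d\<close>.
\<close>

definition abs_continuous_curve :: "real \<Rightarrow> real \<Rightarrow> (real \<Rightarrow> 'a::metric_space) \<Rightarrow> bool" where
  "abs_continuous_curve a b f \<longleftrightarrow>
     (\<forall>\<epsilon>>0. \<exists>\<delta>>0. \<forall>D.
        finite D \<and>
        (\<forall>(c, d) \<in> D. a \<le> c \<and> c \<le> d \<and> d \<le> b) \<and>
        pairwise (\<lambda>(c, d) (c', d'). {c<..<d} \<inter> {c'<..<d'} = {}) D \<and>
        (\<Sum>(c, d) \<in> D. d - c) < \<delta>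
        \<longrightarrow> (\<Sum>(c, d) \<in> D. dist (f c) (f d)) < \<epsilon>)"

definition trajectory ::
    "real \<Rightarrow> (real \<Rightarrow> real ^ 5) \<Rightarrow> (real \<Rightarrow> real) \<Rightarrow> (real \<Rightarrow> real) \<Rightarrow> bool" where
  "trajectory T q u1 u2 \<longleftrightarrow>
     T > 0 \<and>
     abs_continuous_curve 0 T q \<and>
     u1 \<in> borel_measurable (lebesgue_on {0..T}) \<and>
     u2 \<in> borel_measurable (lebesgue_on {0..T}) \<and>
     (\<forall>t\<in>{0..T}. max \<bar>u1 t\<bar> \<bar>u2 t\<bar> \<le> 1) \<and>
     (AE t in lebesgue_on {0..T}.
        (q has_vector_derivative (u1 t *\<^sub>R X1 (q t) + u2 t *\<^sub>R X2 (q t))) (at t within {0..T}))"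

definition normal_extremal ::
    "real \<Rightarrow> (real \<Rightarrow> real ^ 5) \<Rightarrow> (real \<Rightarrow> real) \<Rightarrow> (real \<Rightarrow> real) \<Rightarrow> (real \<Rightarrow> cotangent) \<Rightarrow> bool" where
  "normal_extremal T q u1 u2 \<xi> \<longleftrightarrow>
     trajectory T q u1 u2 \<and>
     (\<forall>t\<in>{0..T}. fst (\<xi> t) = q t) \<and>
     (\<exists>L. L-lipschitz_on {0..T} \<xi>) \<and>
     (\<exists>H>0. AE t in lebesgue_on {0..T}.
        ((\<lambda>s. h1 (\<xi> s)) has_real_derivative (- u2 t * h3 (\<xi> t))) (at t within {0..T}) \<and>
        ((\<lambda>s. h2 (\<xi> s)) has_real_derivative (u1 t * h3 (\<xi> t))) (at t within {0..T}) \<and>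
        ((\<lambda>s. h3 (\<xi> s)) has_real_derivative (u1 t * h4 (\<xi> t) + u2 t * h5 (\<xi> t)))
          (at t within {0..T}) \<and>
        ((\<lambda>s. h4 (\<xi> s)) has_real_derivative 0) (at t within {0..T}) \<and>
        ((\<lambda>s. h5 (\<xi> s)) has_real_derivative 0) (at t within {0..T}) \<and>
        u1 t * h1 (\<xi> t) + u2 t * h2 (\<xi> t) = \<bar>h1 (\<xi> t)\<bar> + \<bar>h2 (\<xi> t)\<bar> \<and>
        \<bar>h1 (\<xi> t)\<bar> + \<bar>h2 (\<xi> t)\<bar> = H)"

end

theory Submission
  imports Defs
begin

text \<open>
  The zero set \<open>Z\<close> of \<open>h1 * h2\<close> along the extremal is compact, so the theorem says that \<open>Z\<close> has
  finitely many connected components, that is, a finite frontier; the times \<open>\<tau> i\<close> are the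
  frontier points of \<open>Z\<close> in increasing order (\<open>finite_frontier_enumeration\<close>).  On a segment
  contained in \<open>Z\<close> only one of \<open>h1\<close>, \<open>h2\<close> can vanish, because \<open>\<bar>h1\<bar> + \<bar>h2\<bar> = H > 0\<close> and the
  segment is connected.  By compactness it is enough to study \<open>Z\<close> near one of its points.

  Near a zero of \<open>h1\<close>, the function \<open>h2\<close> keeps its sign \<open>\<sigma>\<close>, so the maximum condition forces
  \<open>u2 = \<sigma>\<close>, and \<open>x = h1\<close>, \<open>y = \<sigma> h3\<close> obey
    \<open>x' = - y\<close>,  \<open>y' = p u + r\<close>,  \<open>u x = \<bar>x\<bar>\<close>
  with constants \<open>p\<close>, \<open>r\<close> built from \<open>h4\<close>, \<open>h5\<close>, \<open>\<sigma>\<close>.  The same happens near a zero of \<open>h2\<close>.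
  This is the Hamiltonian flow of a particle in the piecewise linear potential \<open>p \<bar>x\<bar> + r x\<close>,
  and the energy \<open>E = y\<^sup>2 / 2 + p \<bar>x\<bar> + r x\<close> is conserved, even through zeros of \<open>x\<close> and even
  where the control is singular.  This gives a dichotomy (\<open>zeros_finite_or_interval\<close>):

  \<^item> If \<open>E \<noteq> 0\<close>, then \<open>x' = - y \<noteq> 0\<close> at every zero of \<open>x\<close>; zeros are isolated, hence finite in number.

  \<^item> If \<open>E = 0\<close>, there is no excursion away from \<open>x = 0\<close> and back: at an interior point of such an
    excursion with \<open>y = 0\<close> the potential vanishes while \<open>x \<noteq> 0\<close>, so the potential vanishes on that
    whole side of \<open>0\<close>, thus \<open>y = 0\<close> and \<open>x\<close> is constant throughout.  So the zeros form an interval.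

  The differential equations hold only almost everywhere.  The bridge from there to statements about
  all times is that a Lipschitz function with derivative zero almost everywhere is constant.
\<close>

section \<open>Lipschitz functions differentiable almost everywhere\<close>

text \<open>
  Adding the slope \<open>C + 1\<close> turns \<open>f\<close> into a strictly increasing \<open>g\<close> whose derivative is \<open>C + 1\<close> off
  the null set \<open>N\<close>.  The change of variables formula off \<open>N\<close> then computes the length \<open>g b - g a\<close> of
  the image, because the Lipschitz map \<open>g\<close> sends \<open>N\<close> to a null set.
\<close>

lemma lipschitz_zero_derivative_endpoints:
  fixes f :: "real \<Rightarrow> real"
  assumes ab: "a \<le> b" and lip: "C-lipschitz_on {a..b} f" and N: "negligible N"
    and der: "\<And>t. t \<in> {a..b} - N \<Longrightarrow> (f has_real_derivative 0) (at t within {a..b})"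
  shows "f a = f b"
proof -
  define g where "g t = f t + (C + 1) * t" for t
  have C: "0 \<le> C"
    using lip by (rule lipschitz_on_nonneg)
  have mono: "g s < g t" if "s \<in> {a..b}" "t \<in> {a..b}" "s < t" for s t
  proof -
    have "f s - f t \<le> C * (t - s)"
      using lipschitz_onD[OF lip that(1,2)] that(3) by (simp add: dist_real_def)
    then show ?thesis
      using that(3) by (simp add: g_def algebra_simps)
  qed
  have inj: "inj_on g {a..b}"
    by (metis inj_onI linorder_cases mono order_less_irrefl)
  have contg: "continuous_on {a..b} g"
    unfolding g_def by (intro continuous_intros lipschitz_on_continuous_on[OF lip])
  have gab: "g a \<le> g b"
    using mono[of a b] ab by (cases "a = b") auto
  have img: "g ` {a..b} = {g a..g b}"
    using continuous_injective_image_segment_1[of a b g] contg inj ab gab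
    by (simp add: closed_segment_eq_real_ivl)
  define S where "S = {a..b} - N"
  have S: "S \<in> sets lebesgue"
    unfolding S_def using N by (simp add: negligible_iff_null_sets null_setsD2 sets.Diff)
  have derg: "(g has_real_derivative (C + 1)) (at t within S)" if "t \<in> S" for t
  proof -
    have "(f has_real_derivative 0) (at t within S)"
      using der[of t] that unfolding S_def by (auto intro: DERIV_subset)
    then show ?thesis
      unfolding g_def by (auto intro!: derivative_eq_intros)
  qed
  have glip: "\<bar>g s - g t\<bar> \<le> (2 * C + 1) * \<bar>s - t\<bar>" if "s \<in> {a..b}" "t \<in> {a..b}" for s t
  proof -
    have "\<bar>g s - g t\<bar> \<le> \<bar>f s - f t\<bar> + \<bar>(C + 1) * (s - t)\<bar>"
      by (simp add: g_def algebra_simps)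
    also have "\<bar>f s - f t\<bar> \<le> C * \<bar>s - t\<bar>"
      using lipschitz_onD[OF lip that] by (simp add: dist_real_def)
    also have "\<bar>(C + 1) * (s - t)\<bar> = (C + 1) * \<bar>s - t\<bar>"
      using C by (simp add: abs_mult)
    finally show ?thesis
      by (simp add: algebra_simps)
  qed
  have "negligible (g ` ({a..b} \<inter> N))"
  proof (rule negligible_locally_Lipschitz_image)
    show "negligible ({a..b} \<inter> N)"
      using N negligible_Int by blast
    show "\<exists>U B. open U \<and> t \<in> U \<and> (\<forall>s\<in>({a..b} \<inter> N) \<inter> U. norm (g s - g t) \<le> B * norm (s - t))"
      if "t \<in> {a..b} \<inter> N" for t
      using that glip by (intro exI[of _ UNIV] exI[of _ "2 * C + 1"]) auto
  qed simp
  moreover have "{g a..g b} - g ` S \<subseteq> g ` ({a..b} \<inter> N)" "g ` S - {g a..g b} = {}"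
    using img by (auto simp: S_def)
  ultimately have spike: "negligible ({g a..g b} - g ` S)" "negligible (g ` S - {g a..g b})"
    by (auto intro: negligible_subset)
  have "((\<lambda>_. 1::real) has_integral (g b - g a)) {g a..g b}"
    using has_integral_const_real[of "1::real" "g a" "g b"] gab by simp
  moreover have "negligible {x \<in> {g a..g b} - g ` S. (1::real) \<noteq> 0}"
    "negligible {x \<in> g ` S - {g a..g b}. (1::real) \<noteq> 0}"
    using spike by (simp_all add: set_diff_eq)
  ultimately have int1: "((\<lambda>_. 1::real) has_integral (g b - g a)) (g ` S)"
    using has_integral_spike_set_eq[of "g ` S" "{g a..g b}" "\<lambda>_. 1::real"] by blast
  have "((\<lambda>_. C + 1) has_integral (C + 1) * (b - a)) {a..b}"
    using has_integral_const_real[of "C + 1" a b] ab by (simp add: mult.commute)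
  moreover have "negligible {x \<in> {a..b} - S. C + 1 \<noteq> 0}" "negligible {x \<in> S - {a..b}. C + 1 \<noteq> 0}"
    by (rule negligible_subset[OF N], force simp: S_def)+
  ultimately have intS: "((\<lambda>_. C + 1) has_integral (C + 1) * (b - a)) S"
    using has_integral_spike_set_eq[of S "{a..b}" "\<lambda>_. C + 1"] by blast
  have "(\<lambda>t. \<bar>C + 1\<bar> * 1) absolutely_integrable_on S \<and>
        integral S (\<lambda>t. \<bar>C + 1\<bar> * 1) = (C + 1) * (b - a)"
    using intS C by (auto intro: nonnegative_absolutely_integrable_1 has_integral_integrable)
  then have "integral (g ` S) (\<lambda>_. 1::real) = (C + 1) * (b - a)"
    using has_absolute_integral_change_of_variables_1'[OF S derg,
        where f = "\<lambda>_. 1" and b = "(C + 1) * (b - a)"] inj_on_subset[OF inj]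
    by (auto simp: S_def)
  with int1 have "(C + 1) * (b - a) = g b - g a"
    by (simp add: integral_unique)
  then show ?thesis
    by (simp add: g_def algebra_simps)
qed


lemma lipschitz_zero_derivative_constant:
  fixes f :: "real \<Rightarrow> real"
  assumes lip: "C-lipschitz_on {a..b} f" and N: "negligible N"
    and der: "\<And>t. t \<in> {a..b} - N \<Longrightarrow> (f has_real_derivative 0) (at t within {a..b})"
    and "s \<in> {a..b}" "t \<in> {a..b}"
  shows "f s = f t"
proof -
  have "f s' = f t'" if "s' \<le> t'" "s' \<in> {a..b}" "t' \<in> {a..b}" for s' t'
  proof (rule lipschitz_zero_derivative_endpoints[OF that(1) _ N])
    show "C-lipschitz_on {s'..t'} f"
      using that by (intro lipschitz_on_subset[OF lip]) auto
    show "(f has_real_derivative 0) (at r within {s'..t'})" if "r \<in> {s'..t'} - N" for r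
      using that \<open>s' \<in> {a..b}\<close> \<open>t' \<in> {a..b}\<close>
      by (intro DERIV_subset[OF der[of r]]) auto
  qed
  from this[of s t] this[of t s] assms(4,5) show ?thesis
    by linarith
qed

text \<open>
  Compare \<open>f\<close> with the primitive of the continuous function \<open>g\<close>: their difference is Lipschitz with
  derivative zero almost everywhere.  Applied to \<open>h1\<close> and \<open>h2\<close>, this makes them continuously
  differentiable wherever the sign of the other component is fixed.
\<close>
lemma lipschitz_derivative_everywhere:
  fixes f :: "real \<Rightarrow> real"
  assumes lip: "C-lipschitz_on {a..b} f" and N: "negligible N"
    and cont: "continuous_on {a..b} g"
    and der: "\<And>t. t \<in> {a..b} - N \<Longrightarrow> (f has_real_derivative g t) (at t within {a..b})"
    and t: "t \<in> {a..b}"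
  shows "(f has_real_derivative g t) (at t within {a..b})"
proof -
  define G where "G t = integral {a..t} g" for t
  have G: "(G has_real_derivative g s) (at s within {a..b})" if "s \<in> {a..b}" for s
    unfolding G_def using integral_has_real_derivative[OF cont that] .
  obtain B where B: "\<And>s. s \<in> {a..b} \<Longrightarrow> norm (g s) \<le> B" and "0 \<le> B"
    using compact_imp_bounded[OF compact_continuous_image[OF cont]]
    by (auto simp: bounded_iff) (metis abs_ge_zero order_trans t atLeastAtMost_iff)
  have "B-lipschitz_on {a..b} G"
    using field_differentiable_bound[OF convex_real_interval(5) G B] \<open>0 \<le> B\<close>
    by (intro lipschitz_onI) (auto simp: dist_norm)
  then have lipd: "(C + B)-lipschitz_on {a..b} (\<lambda>s. f s - G s)"
    by (intro lipschitz_on_diff lip)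
  have const: "f s - G s = f t - G t" if "s \<in> {a..b}" for s
  proof (rule lipschitz_zero_derivative_constant[OF lipd N _ that t])
    show "((\<lambda>s. f s - G s) has_real_derivative 0) (at r within {a..b})"
      if "r \<in> {a..b} - N" for r
      using DERIV_diff[OF der[OF that] G[of r]] that by simp
  qed
  have "((\<lambda>s. G s + (f t - G t)) has_real_derivative g t) (at t within {a..b})"
    using G[OF t] by (auto intro!: derivative_eq_intros)
  then show ?thesis
    by (rule has_field_derivative_transform_within[OF _ zero_less_one t])
      (use const in \<open>auto simp: algebra_simps\<close>)
qed

lemma derivative_zero_at_limit_of_zeros:
  fixes f :: "real \<Rightarrow> real"
  assumes der: "(f has_real_derivative D) (at t within S)"
    and lim: "t islimpt {s \<in> S. f s = 0}" and ft: "f t = 0"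
  shows "D = 0"
proof (rule ccontr)
  assume "D \<noteq> 0"
  have "((\<lambda>s. (f s - f t) / (s - t)) \<longlongrightarrow> D) (at t within S)"
    using der by (simp add: has_field_derivative_iff)
  then have "\<forall>\<^sub>F s in at t within S. (f s - f t) / (s - t) \<noteq> 0"
    using \<open>D \<noteq> 0\<close> by (rule tendsto_imp_eventually_ne)
  then have "\<forall>\<^sub>F s in at t. s \<notin> {s \<in> S. f s = 0}"
    by (auto simp: eventually_at_filter ft elim: eventually_mono)
  with lim show False
    by (simp add: islimpt_iff_eventually)
qed

text \<open>
  Zeros with \<open>\<bar>f'\<bar> \<ge> 1 / (n + 1)\<close> form a compact set without limit points, that is, a finite set.
  These zeros are the only places where \<open>\<bar>f\<bar>\<close> can fail to be differentiable.
\<close>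
lemma negligible_transversal_zeros:
  fixes f :: "real \<Rightarrow> real"
  assumes contf: "continuous_on {a..b} f" and contg: "continuous_on {a..b} g"
    and der: "\<And>t. t \<in> {a..b} \<Longrightarrow> (f has_real_derivative g t) (at t within {a..b})"
  shows "negligible {t \<in> {a..b}. f t = 0 \<and> g t \<noteq> 0}"
proof -
  let ?S = "\<lambda>n. {t \<in> {a..b}. f t = 0 \<and> inverse (Suc n) \<le> \<bar>g t\<bar>}"
  have "finite ({a..b} \<inter> ?S n)" for n
  proof (rule finite_not_islimpt_in_compact)
    fix t assume t: "t \<in> {a..b}"
    show "\<not> t islimpt ?S n"
    proof
      assume lim: "t islimpt ?S n"
      have "closed ({t \<in> {a..b}. f t = 0} \<inter> {t \<in> {a..b}. inverse (Suc n) \<le> \<bar>g t\<bar>})"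
        by (intro closed_Int continuous_closed_preimage_constant[OF contf]
            continuous_on_closed_Collect_le continuous_intros contg) auto
      moreover have "?S n = {t \<in> {a..b}. f t = 0} \<inter> {t \<in> {a..b}. inverse (Suc n) \<le> \<bar>g t\<bar>}"
        by auto
      ultimately have "t \<in> ?S n"
        using lim by (metis closed_limpt)
      moreover have "g t = 0"
      proof (rule derivative_zero_at_limit_of_zeros[OF der[OF t]])
        show "t islimpt {s \<in> {a..b}. f s = 0}"
          using lim by (rule islimpt_subset) auto
      qed (use \<open>t \<in> ?S n\<close> in auto)
      ultimately show False
        by simp
    qed
  qed auto
  then have "finite (?S n)" for n
    by (simp add: Int_absorb1 subset_iff)
  then have "negligible (\<Union>n. ?S n)"
    by (intro negligible_Union_nat negligible_finite)
  moreover have "{t \<in> {a..b}. f t = 0 \<and> g t \<noteq> 0} \<subseteq> (\<Union>n. ?S n)"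
  proof
    fix t assume t: "t \<in> {t \<in> {a..b}. f t = 0 \<and> g t \<noteq> 0}"
    then obtain n where "inverse (real (Suc n)) < \<bar>g t\<bar>"
      using reals_Archimedean[of "\<bar>g t\<bar>"] by auto
    then show "t \<in> (\<Union>n. ?S n)"
      using t by (intro UN_I[of n]) auto
  qed
  ultimately show ?thesis
    by (rule negligible_subset)
qed

section \<open>Excursions away from zero\<close>

text \<open>
  Compactness of the zero set yields a last zero before \<open>t\<close> and a first zero after \<open>t\<close>; between them
  the sign is constant by the intermediate value theorem.
\<close>
lemma gap_around_nonzero:
  fixes f :: "real \<Rightarrow> real"
  assumes cont: "continuous_on {a..b} f" and t: "t \<in> {a..b}" and ft: "f t \<noteq> 0"
    and fa: "f a = 0" and fb: "f b = 0"
  obtains c d where "a \<le> c" "c < t" "t < d" "d \<le> b" "f c = 0" "f d = 0"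
    "\<And>s. c < s \<Longrightarrow> s < d \<Longrightarrow> sgn (f s) = sgn (f t)"
proof -
  have comp: "compact {s \<in> {u..v}. f s = 0}" if "{u..v} \<subseteq> {a..b}" for u v
  proof -
    have "closed {s \<in> {u..v}. f s = 0}"
      by (intro continuous_closed_preimage_constant continuous_on_subset[OF cont that]) auto
    moreover have "bounded {s \<in> {u..v}. f s = 0}"
      by (rule bounded_subset[of "{u..v}"]) auto
    ultimately show ?thesis
      by (simp add: compact_eq_bounded_closed)
  qed
  obtain c where c: "c \<in> {s \<in> {a..t}. f s = 0}"
    and cmax: "\<And>s. s \<in> {s \<in> {a..t}. f s = 0} \<Longrightarrow> s \<le> c"
    using compact_attains_sup[OF comp[of a t]] t fa by auto
  obtain d where d: "d \<in> {s \<in> {t..b}. f s = 0}"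
    and dmin: "\<And>s. s \<in> {s \<in> {t..b}. f s = 0} \<Longrightarrow> d \<le> s"
    using compact_attains_inf[OF comp[of t b]] t fb by auto
  have nz: "f s \<noteq> 0" if "c < s" "s < d" for s
    using cmax[of s] dmin[of s] that c d by (cases "s \<le> t") auto
  have "sgn (f s) = sgn (f t)" if s: "c < s" "s < d" for s
  proof (rule ccontr)
    assume ne: "sgn (f s) \<noteq> sgn (f t)"
    have tcd: "t \<in> {c<..<d}"
      using c d ft by (auto simp: less_le)
    have "connected (f ` {c<..<d})"
      by (intro connected_continuous_image continuous_on_subset[OF cont]) (use c d in auto)
    moreover have "f s \<in> f ` {c<..<d}" "f t \<in> f ` {c<..<d}"
      using s tcd by auto
    moreover have "f s \<le> 0 \<and> 0 \<le> f t \<or> f t \<le> 0 \<and> 0 \<le> f s"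
      using ne by (auto simp: sgn_if split: if_splits)
    ultimately have "0 \<in> f ` {c<..<d}"
      using connectedD_interval by blast
    then show False
      using nz by auto
  qed
  then show thesis
    using c d ft by (intro that[of c d]) (auto simp: less_le)
qed

section \<open>Products of Lipschitz functions\<close>

lemma (in bounded_bilinear) lipschitz_on_prod:
  assumes S: "compact S" and f: "\<exists>C. C-lipschitz_on S f" and g: "\<exists>D. D-lipschitz_on S g"
  shows "\<exists>E. E-lipschitz_on S (\<lambda>t. prod (f t) (g t))"
proof -
  obtain C D where C: "C-lipschitz_on S f" and D: "D-lipschitz_on S g"
    using f g by blast
  obtain A where A: "0 < A" "\<And>t. t \<in> S \<Longrightarrow> norm (f t) \<le> A"
    using compact_imp_bounded[OF compact_continuous_image[OF lipschitz_on_continuous_on[OF C] S]]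
    by (auto simp: bounded_pos)
  obtain B where B: "0 < B" "\<And>t. t \<in> S \<Longrightarrow> norm (g t) \<le> B"
    using compact_imp_bounded[OF compact_continuous_image[OF lipschitz_on_continuous_on[OF D] S]]
    by (auto simp: bounded_pos)
  obtain K where K: "0 < K" "\<And>a b. norm (prod a b) \<le> norm a * norm b * K"
    using pos_bounded by blast
  have "(K * (C * B + A * D))-lipschitz_on S (\<lambda>t. prod (f t) (g t))"
  proof (rule lipschitz_onI)
    fix s t assume st: "s \<in> S" "t \<in> S"
    have Cd: "norm (f s - f t) \<le> C * dist s t" and Dd: "norm (g s - g t) \<le> D * dist s t"
      using lipschitz_onD[OF C st] lipschitz_onD[OF D st] by (auto simp: dist_norm)
    have "prod (f s) (g s) - prod (f t) (g t) = prod (f s - f t) (g s) + prod (f t) (g s - g t)"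
      by (simp add: diff_left diff_right)
    then have "norm (prod (f s) (g s) - prod (f t) (g t))
        \<le> norm (f s - f t) * norm (g s) * K + norm (f t) * norm (g s - g t) * K"
      using K(2) by (metis add_mono norm_triangle_le)
    also have "\<dots> \<le> (C * dist s t) * B * K + A * (D * dist s t) * K"
      using A B K(1) Cd Dd st
      by (intro add_mono mult_right_mono mult_mono) (auto intro: order_trans[OF norm_ge_zero])
    finally show "dist (prod (f s) (g s)) (prod (f t) (g t)) \<le> K * (C * B + A * D) * dist s t"
      by (simp add: dist_norm algebra_simps)
  qed (use A B K(1) lipschitz_on_nonneg[OF C] lipschitz_on_nonneg[OF D] in auto)
  then show ?thesis
    by blast
qed

section \<open>Motion in a piecewise linear potential\<close>

text \<open>
  The reduced dynamics near a point where one component vanishes: \<open>x\<close> is the vanishing component,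
  \<open>u\<close> its control, and \<open>y\<close> is \<open>h3\<close> up to sign.  The control is \<open>sgn (x t)\<close> when \<open>x t \<noteq> 0\<close> and is left
  undetermined by \<open>bang\<close> at zeros of \<open>x\<close>, which covers singular arcs.
\<close>
locale switching_arc =
  fixes x y u :: "real \<Rightarrow> real" and a b p r :: real and N :: "real set"
  assumes lip_x: "\<exists>C. C-lipschitz_on {a..b} x" and lip_y: "\<exists>C. C-lipschitz_on {a..b} y"
    and N: "negligible N"
    and deriv_x_ae: "t \<in> {a..b} - N \<Longrightarrow> (x has_real_derivative - y t) (at t within {a..b})"
    and deriv_y: "t \<in> {a..b} - N \<Longrightarrow> (y has_real_derivative u t * p + r) (at t within {a..b})"
    and bang: "t \<in> {a..b} - N \<Longrightarrow> u t * x t = \<bar>x t\<bar>"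
begin

definition energy :: "real \<Rightarrow> real" where
  "energy t = (y t)\<^sup>2 / 2 + p * \<bar>x t\<bar> + r * x t"

lemma cont_x: "continuous_on {a..b} x" and cont_y: "continuous_on {a..b} y"
  by (rule exE[OF lip_x], erule lipschitz_on_continuous_on)
    (rule exE[OF lip_y], erule lipschitz_on_continuous_on)

lemma deriv_x:
  assumes "t \<in> {a..b}"
  shows "(x has_real_derivative - y t) (at t within {a..b})"
proof -
  obtain C where C: "C-lipschitz_on {a..b} x"
    using lip_x ..
  show ?thesis
    by (rule lipschitz_derivative_everywhere[OF C N continuous_on_minus[OF cont_y] deriv_x_ae assms])
qed

lemma lip_energy: "\<exists>C. C-lipschitz_on {a..b} energy"
proof -
  have "\<exists>C. C-lipschitz_on {a..b} (\<lambda>t. y t * y t)"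
    using bounded_bilinear.lipschitz_on_prod[OF bounded_bilinear_mult compact_Icc lip_y lip_y] .
  then obtain A where A: "A-lipschitz_on {a..b} (\<lambda>t. y t * y t)" ..
  obtain B where B: "B-lipschitz_on {a..b} x"
    using lip_x ..
  have B': "B-lipschitz_on {a..b} (\<lambda>t. \<bar>x t\<bar>)"
  proof (rule lipschitz_onI)
    show "dist \<bar>x s\<bar> \<bar>x t\<bar> \<le> B * dist s t" if "s \<in> {a..b}" "t \<in> {a..b}" for s t
      using lipschitz_onD[OF B that] abs_triangle_ineq3[of "x s" "x t"] by (simp add: dist_real_def)
  qed (rule lipschitz_on_nonneg[OF B])
  have "energy = (\<lambda>t. (1/2) * (y t * y t) + p * \<bar>x t\<bar> + r * x t)"
    by (auto simp: energy_def power2_eq_square)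
  then show ?thesis
    using lipschitz_on_add[OF lipschitz_on_add[OF lipschitz_on_cmult_real[OF A, of "1/2"]
        lipschitz_on_cmult_real[OF B', of p]] lipschitz_on_cmult_real[OF B, of r]] by auto
qed

text \<open>
  Where \<open>x t \<noteq> 0\<close> the control is \<open>sgn (x t)\<close> and the chain rule applies.  At a zero with
  \<open>y t = 0\<close> both \<open>x\<close> and \<open>\<bar>x\<bar>\<close> have derivative zero, so every value of the control is compatible
  with conservation.
\<close>
lemma deriv_energy:
  assumes t: "t \<in> {a..b} - (N \<union> {t \<in> {a..b}. x t = 0 \<and> - y t \<noteq> 0})"
  shows "(energy has_real_derivative 0) (at t within {a..b})"
proof -
  have dx: "(x has_real_derivative - y t) (at t within {a..b})"
    and dy: "(y has_real_derivative u t * p + r) (at t within {a..b})"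
    using t deriv_x deriv_y by auto
  have dabs: "((\<lambda>t. \<bar>x t\<bar>) has_real_derivative - (u t * y t)) (at t within {a..b})"
  proof (cases "x t = 0")
    case True
    then have "(x has_real_derivative 0) (at t within {a..b})" and "y t = 0"
      using t dx by auto
    then have "((\<lambda>s. (x s - 0) / (s - t)) \<longlongrightarrow> 0) (at t within {a..b})"
      by (simp add: has_field_derivative_iff True)
    then have "((\<lambda>s. \<bar>x s\<bar> / (s - t)) \<longlongrightarrow> 0) (at t within {a..b})"
      by (subst (asm) tendsto_rabs_zero_iff[symmetric], subst tendsto_rabs_zero_iff[symmetric])
        (simp add: abs_divide)
    then show ?thesis
      using True \<open>y t = 0\<close> by (simp add: has_field_derivative_iff)
  next
    case False
    then have u: "u t = sgn (x t)"
      using bang[of t] t by (simp add: real_sgn_eq eq_divide_eq abs_if sgn_if split: if_splits)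
    have "((\<lambda>s. sgn (x t) * x s) has_real_derivative - (u t * y t)) (at t within {a..b})"
      using dx u by (auto intro!: derivative_eq_intros)
    moreover have "\<forall>\<^sub>F s in at t within {a..b}. sgn (x t) * x s = \<bar>x s\<bar>"
    proof -
      have "((\<lambda>s. sgn (x t) * x s) \<longlongrightarrow> sgn (x t) * x t) (at t within {a..b})"
        using cont_x t by (auto intro!: tendsto_intros simp: continuous_on)
      then have "\<forall>\<^sub>F s in at t within {a..b}. 0 < sgn (x t) * x s"
        by (rule order_tendstoD) (use False in \<open>auto simp: sgn_if\<close>)
      then show ?thesis
        by (rule eventually_mono) (auto simp: sgn_if split: if_splits)
    qed
    ultimately show ?thesis
      using False by (subst (asm) has_field_derivative_cong_eventually) (auto simp: sgn_if)
  qed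
  have "((\<lambda>s. (y s)\<^sup>2 / 2 + p * \<bar>x s\<bar> + r * x s) has_real_derivative
      2 * y t * (u t * p + r) / 2 + p * - (u t * y t) + r * - y t) (at t within {a..b})"
    using dx dy dabs by (auto intro!: derivative_eq_intros)
  moreover have "2 * y t * (u t * p + r) / 2 + p * - (u t * y t) + r * - y t = 0"
    by (simp add: field_simps)
  ultimately show ?thesis
    by (simp only: energy_def[abs_def])
qed

lemma energy_constant:
  assumes "s \<in> {a..b}" "t \<in> {a..b}"
  shows "energy s = energy t"
proof -
  obtain C where C: "C-lipschitz_on {a..b} energy"
    using lip_energy ..
  have "negligible {t \<in> {a..b}. x t = 0 \<and> - y t \<noteq> 0}"
    by (rule negligible_transversal_zeros[OF cont_x continuous_on_minus[OF cont_y] deriv_x])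
  then have "negligible (N \<union> {t \<in> {a..b}. x t = 0 \<and> - y t \<noteq> 0})"
    by (rule negligible_Un[OF N])
  from lipschitz_zero_derivative_constant[OF C this deriv_energy assms] show ?thesis .
qed

text \<open>
  On an excursion the sign of \<open>x\<close> is fixed, so the potential is a constant multiple of \<open>\<bar>x\<bar>\<close>.
  Rolle's theorem provides a point of the excursion with \<open>y = 0\<close>; zero energy makes the multiple
  vanish, and then \<open>y\<close> vanishes on the whole excursion.
\<close>
lemma no_gap_at_zero_energy:
  assumes E: "\<And>t. t \<in> {a..b} \<Longrightarrow> energy t = 0"
    and s: "s1 \<in> {a..b}" "s2 \<in> {a..b}" "x s1 = 0" "x s2 = 0" and t: "t \<in> {s1..s2}"
  shows "x t = 0"
proof (rule ccontr)
  assume xt: "x t \<noteq> 0"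
  obtain c d where cd: "s1 \<le> c" "c < t" "t < d" "d \<le> s2" "x c = 0" "x d = 0"
    and sg: "\<And>v. c < v \<Longrightarrow> v < d \<Longrightarrow> sgn (x v) = sgn (x t)"
    using gap_around_nonzero[OF continuous_on_subset[OF cont_x, of "{s1..s2}"] t xt s(3,4)] s by auto
  have der: "(x has_real_derivative - y v) (at v)" if "c < v" "v < d" for v
    using deriv_x[of v] at_within_Icc_at[of a v b] that cd s by auto
  have contx: "continuous_on {c..d} x"
    using continuous_on_subset[OF cont_x] cd s by auto
  have en: "(y v)\<^sup>2 / 2 + (p + r * sgn (x t)) * \<bar>x v\<bar> = 0" if "c < v" "v < d" for v
  proof -
    have "x v = sgn (x t) * \<bar>x v\<bar>"
      using sg[OF that] by (metis mult_sgn_abs mult.commute)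
    then show ?thesis
      using E[of v] that cd s unfolding energy_def by (simp add: algebra_simps)
  qed
  obtain v where v: "c < v" "v < d" "(x has_real_derivative 0) (at v)"
    using Rolle[of c d x] cd contx der by (auto simp: real_differentiable_def)
  have "y v = 0"
    using DERIV_unique[OF v(3) der[OF v(1,2)]] by simp
  moreover have "x v \<noteq> 0"
    using sg[OF v(1,2)] xt by (auto simp: sgn_if split: if_splits)
  ultimately have "p + r * sgn (x t) = 0"
    using en[OF v(1,2)] by simp
  then have "y v = 0" if "c < v" "v < d" for v
    using en[OF that] by simp
  then have "x t = x c"
    using DERIV_isconst2[of c d x t] cd contx der by auto
  with xt cd(5) show False
    by simp
qed

text \<open>
  A limit point of zeros is a zero at which \<open>x' = - y\<close> vanishes too, so the energy is zero there and
  therefore everywhere.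
\<close>
lemma zeros_finite_or_interval:
  "finite {t \<in> {a..b}. x t = 0} \<or> is_interval {t \<in> {a..b}. x t = 0}"
proof (rule disjCI)
  assume nonint: "\<not> is_interval {t \<in> {a..b}. x t = 0}"
  have "\<not> t islimpt {t \<in> {a..b}. x t = 0}" if t: "t \<in> {a..b}" for t
  proof
    assume lim: "t islimpt {t \<in> {a..b}. x t = 0}"
    have "closed {t \<in> {a..b}. x t = 0}"
      by (intro continuous_closed_preimage_constant cont_x) auto
    then have xt: "x t = 0"
      using lim closed_limpt by blast
    have "y t = 0"
      using derivative_zero_at_limit_of_zeros[OF deriv_x[OF t] lim xt] by simp
    then have "energy s = 0" if "s \<in> {a..b}" for s
      using energy_constant[OF that t] xt by (simp add: energy_def)
    then have "is_interval {t \<in> {a..b}. x t = 0}"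
      unfolding is_interval_1
    proof (intro ballI allI impI)
      fix s1 s2 s
      assume "s1 \<in> {t \<in> {a..b}. x t = 0}" "s2 \<in> {t \<in> {a..b}. x t = 0}" "s1 \<le> s \<and> s \<le> s2"
      then show "s \<in> {t \<in> {a..b}. x t = 0}"
        using no_gap_at_zero_energy[of s1 s2 s] \<open>\<And>s. s \<in> {a..b} \<Longrightarrow> energy s = 0\<close> by auto
    qed
    with nonint show False ..
  qed
  then have "finite ({a..b} \<inter> {t \<in> {a..b}. x t = 0})"
    by (intro finite_not_islimpt_in_compact) auto
  moreover have "{a..b} \<inter> {t \<in> {a..b}. x t = 0} = {t \<in> {a..b}. x t = 0}"
    by blast
  ultimately show "finite {t \<in> {a..b}. x t = 0}"
    by simp
qed

end

section \<open>Compact sets of reals with finite frontier\<close>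

text \<open>
  An interval between consecutive frontier points contains no frontier point, so being connected it
  lies either inside \<open>Z\<close> or outside \<open>Z\<close>.  The extreme points of \<open>Z\<close> are frontier points.
\<close>
lemma finite_frontier_enumeration:
  fixes Z :: "real set"
  assumes Z: "compact Z" and fin: "finite (frontier Z)"
  shows "\<exists>(n::nat) (\<tau>::nat \<Rightarrow> real). (\<forall>i\<in>{1..n}. \<tau> i \<in> Z) \<and> strict_mono_on {1..n} \<tau> \<and>
    (\<forall>i\<in>{1..<n}. {\<tau> i<..<\<tau> (i + 1)} \<inter> Z = {} \<or> {\<tau> i..\<tau> (i + 1)} \<subseteq> Z) \<and>
    (\<forall>t\<in>Z. \<exists>i\<in>{1..n}. \<exists>j\<in>{1..n}. \<tau> i \<le> t \<and> t \<le> \<tau> j)"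
proof -
  define xs where "xs = sorted_list_of_set (frontier Z)"
  have xs: "set xs = frontier Z" "sorted_wrt (<) xs"
    using fin by (auto simp: xs_def)
  \<comment> \<open>List positions start at \<open>0\<close>, the times at \<open>1\<close>.\<close>
  define \<tau> where "\<tau> i = xs ! (i - 1)" for i
  define n where "n = length xs"
  have sub: "frontier Z \<subseteq> Z"
    using Z compact_imp_closed frontier_subset_closed by blast
  have img: "frontier Z = \<tau> ` {1..n}"
  proof -
    have "frontier Z = (\<lambda>i. xs ! i) ` {..<n}"
      using xs(1) by (auto simp: n_def set_conv_nth)
    also have "{..<n} = (\<lambda>i. i - 1) ` {1..n}"
      by (auto simp: image_iff intro!: bexI[of _ "Suc _"])
    finally show ?thesis
      by (simp add: image_image \<tau>_def)
  qed
  have mono: "strict_mono_on {1..n} \<tau>"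
    using sorted_wrt_nth_less[OF xs(2)] by (auto simp: strict_mono_on_def \<tau>_def n_def)
  have mem: "\<tau> i \<in> Z" if "i \<in> {1..n}" for i
    using sub img that by auto
  have alt: "{\<tau> i<..<\<tau> (i + 1)} \<inter> Z = {} \<or> {\<tau> i..\<tau> (i + 1)} \<subseteq> Z" if i: "i \<in> {1..<n}" for i
  proof -
    have "{\<tau> i<..<\<tau> (i + 1)} \<inter> frontier Z = {}"
    proof -
      have False if "j \<in> {1..n}" "\<tau> i < \<tau> j" "\<tau> j < \<tau> (i + 1)" for j
        using strict_mono_on_less[OF mono, of i j] strict_mono_on_less[OF mono, of j "i + 1"] i that
        by simp
      then show ?thesis
        unfolding img by (force simp del: atLeastAtMost_iff)
    qed
    then have "{\<tau> i<..<\<tau> (i + 1)} \<inter> Z = {} \<or> {\<tau> i<..<\<tau> (i + 1)} - Z = {}"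
      using connected_Int_frontier[of "{\<tau> i<..<\<tau> (i + 1)}" Z] by auto
    moreover have "{\<tau> i..\<tau> (i + 1)} \<subseteq> Z" if "{\<tau> i<..<\<tau> (i + 1)} - Z = {}"
    proof
      fix t assume "t \<in> {\<tau> i..\<tau> (i + 1)}"
      then consider "t = \<tau> i" | "t = \<tau> (i + 1)" | "t \<in> {\<tau> i<..<\<tau> (i + 1)}"
        by fastforce
      then show "t \<in> Z"
        using that mem[of i] mem[of "i + 1"] i by cases auto
    qed
    ultimately show ?thesis
      by blast
  qed
  have enclosed: "\<exists>i\<in>{1..n}. \<exists>j\<in>{1..n}. \<tau> i \<le> t \<and> t \<le> \<tau> j" if t: "t \<in> Z" for t
  proof -
    obtain l where l: "l \<in> Z" "\<And>s. s \<in> Z \<Longrightarrow> l \<le> s"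
      using compact_attains_inf[OF Z] t by auto
    obtain u where u: "u \<in> Z" "\<And>s. s \<in> Z \<Longrightarrow> s \<le> u"
      using compact_attains_sup[OF Z] t by auto
    have "l - 1 \<in> {l - 1..l} - Z" "u + 1 \<in> {u..u + 1} - Z"
      using l(2)[of "l - 1"] u(2)[of "u + 1"] by auto
    moreover have "l \<in> {l - 1..l} \<inter> Z" "u \<in> {u..u + 1} \<inter> Z"
      using l(1) u(1) by auto
    ultimately have "{l - 1..l} \<inter> frontier Z \<noteq> {}" "{u..u + 1} \<inter> frontier Z \<noteq> {}"
      using connected_Int_frontier[OF connected_Icc] by blast+
    then obtain l' u' where "l' \<in> frontier Z" "l' \<le> l" "u' \<in> frontier Z" "u \<le> u'"
      by auto
    then obtain i j where "i \<in> {1..n}" "\<tau> i \<le> l" "j \<in> {1..n}" "u \<le> \<tau> j"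
      unfolding img by blast
    then show ?thesis
      using l(2)[OF t] u(2)[OF t] by (meson order_trans)
  qed
  from mem mono alt enclosed show ?thesis
    by (intro exI[of _ n] exI[of _ \<tau>] conjI ballI)
qed

text \<open>
  An infinite frontier would accumulate at a point of \<open>Z\<close>, but a finite set and a compact interval
  both have finite frontier.
\<close>
lemma finite_frontier_if_locally_finite_or_interval:
  fixes Z :: "real set"
  assumes Z: "compact Z"
    and loc: "\<And>t. t \<in> Z \<Longrightarrow> \<exists>\<delta>>0. finite (Z \<inter> cball t \<delta>) \<or> is_interval (Z \<inter> cball t \<delta>)"
  shows "finite (frontier Z)"
proof (rule ccontr)
  assume inf: "infinite (frontier Z)"
  obtain t where t: "t \<in> Z" and lim: "t islimpt frontier Z"
    using Heine_Borel_imp_Bolzano_Weierstrass[OF Z inf frontier_subset_closed] compact_imp_closed[OF Z]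
    by blast
  obtain \<delta> where "0 < \<delta>" and \<delta>: "finite (Z \<inter> cball t \<delta>) \<or> is_interval (Z \<inter> cball t \<delta>)"
    using loc[OF t] by blast
  have "finite (frontier (Z \<inter> cball t \<delta>))"
    using \<delta>
  proof
    assume fin: "finite (Z \<inter> cball t \<delta>)"
    then show ?thesis
      using frontier_subset_closed[OF finite_imp_closed[OF fin]] finite_subset by blast
  next
    assume "is_interval (Z \<inter> cball t \<delta>)"
    then have "connected (Z \<inter> cball t \<delta>)" "compact (Z \<inter> cball t \<delta>)"
      using Z by (auto simp: is_interval_connected_1 intro: compact_Int)
    then obtain c d where "Z \<inter> cball t \<delta> = {c..d}"
      using connected_compact_interval_1 by blast
    moreover have "frontier {c..d} \<subseteq> {c, d}"
      by (auto simp: frontier_def)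
    ultimately show ?thesis
      by (simp add: finite_subset)
  qed
  moreover have "frontier Z \<inter> ball t \<delta> \<subseteq> frontier (Z \<inter> cball t \<delta>)"
  proof
    fix s assume s: "s \<in> frontier Z \<inter> ball t \<delta>"
    then have "s \<in> Z"
      using frontier_subset_closed[OF compact_imp_closed[OF Z]] by blast
    moreover have "s \<notin> interior (Z \<inter> cball t \<delta>)"
      using s by (auto simp: frontier_def)
    ultimately show "s \<in> frontier (Z \<inter> cball t \<delta>)"
      using s by (auto simp: frontier_def intro: subsetD[OF closure_subset])
  qed
  ultimately have "finite (frontier Z \<inter> ball t \<delta>)"
    by (rule finite_subset[rotated])
  with lim \<open>0 < \<delta>\<close> show False
    by (simp add: islimpt_eq_infinite_ball)
qed


section \<open>Zeros of the switching functions\<close>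

text \<open>
  Here \<open>f\<close> is either of \<open>h1\<close>, \<open>h2\<close> and \<open>g\<close> is the other one; \<open>u\<close> and \<open>v\<close> are the corresponding
  controls, and \<open>c = - 1\<close> or \<open>c = 1\<close> records which of the two cases it is.  Since \<open>g\<close> keeps its
  sign \<open>\<sigma>\<close>, the maximum condition forces \<open>v = \<sigma>\<close>, and \<open>y = - c \<sigma> h\<close> reduces the system to
  \<open>switching_arc\<close>.
\<close>
lemma component_zeros_finite_or_interval:
  fixes f g h u v :: "real \<Rightarrow> real"
  assumes lipf: "\<exists>C. C-lipschitz_on {a..b} f" and liph: "\<exists>C. C-lipschitz_on {a..b} h"
    and contg: "continuous_on {a..b} g" and g: "\<And>t. t \<in> {a..b} \<Longrightarrow> g t \<noteq> 0"
    and N: "negligible N"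
    and uv: "\<And>t. t \<in> {a..b} - N \<Longrightarrow> \<bar>u t\<bar> \<le> 1 \<and> \<bar>v t\<bar> \<le> 1"
    and max: "\<And>t. t \<in> {a..b} - N \<Longrightarrow> u t * f t + v t * g t = \<bar>f t\<bar> + \<bar>g t\<bar>"
    and df: "\<And>t. t \<in> {a..b} - N \<Longrightarrow> (f has_real_derivative c * v t * h t) (at t within {a..b})"
    and dh: "\<And>t. t \<in> {a..b} - N \<Longrightarrow> (h has_real_derivative \<alpha> * u t + \<beta> * v t) (at t within {a..b})"
  shows "finite {t \<in> {a..b}. f t = 0} \<or> is_interval {t \<in> {a..b}. f t = 0}"
proof -
  define \<sigma> where "\<sigma> = sgn (g a)"
  have sg: "sgn (g t) = \<sigma>" if t: "t \<in> {a..b}" for t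
  proof (rule ccontr)
    assume "sgn (g t) \<noteq> \<sigma>"
    then have "g t \<le> 0 \<and> 0 \<le> g a \<or> g a \<le> 0 \<and> 0 \<le> g t"
      by (auto simp: \<sigma>_def sgn_if split: if_splits)
    moreover have "connected (g ` {a..b})" "g t \<in> g ` {a..b}" "g a \<in> g ` {a..b}"
      using t by (auto intro: connected_continuous_image contg)
    ultimately have "0 \<in> g ` {a..b}"
      using connectedD_interval by blast
    then show False
      using g by auto
  qed
  have ctrl: "u t * f t = \<bar>f t\<bar> \<and> v t = \<sigma>" if t: "t \<in> {a..b} - N" for t
  proof -
    have "u t * f t \<le> \<bar>f t\<bar>" "v t * g t \<le> \<bar>g t\<bar>"
      using uv[OF t] mult_left_le_one_le[of "\<bar>f t\<bar>" "\<bar>u t\<bar>"] mult_left_le_one_le[of "\<bar>g t\<bar>" "\<bar>v t\<bar>"]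
        abs_ge_self[of "u t * f t"] abs_ge_self[of "v t * g t"] by (auto simp: abs_mult)
    then have eq: "u t * f t = \<bar>f t\<bar>" "v t * g t = \<bar>g t\<bar>"
      using max[OF t] by linarith+
    have "v t = sgn (g t)"
      using eq(2) g[of t] t by (simp add: real_sgn_eq eq_divide_eq abs_if sgn_if split: if_splits)
    then show ?thesis
      using eq(1) sg[of t] t by auto
  qed
  obtain C where C: "C-lipschitz_on {a..b} h"
    using liph ..
  interpret switching_arc f "\<lambda>t. - (c * \<sigma>) * h t" u a b "- (c * \<sigma> * \<alpha>)" "- (c * \<sigma> * \<beta> * \<sigma>)" N
  proof
    show "\<exists>C. C-lipschitz_on {a..b} (\<lambda>t. - (c * \<sigma>) * h t)"
      using lipschitz_on_cmult_real[OF C] by blast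
    show "(f has_real_derivative - (- (c * \<sigma>) * h t)) (at t within {a..b})" if "t \<in> {a..b} - N" for t
      using df[OF that] ctrl[OF that] by simp
    show "((\<lambda>t. - (c * \<sigma>) * h t) has_real_derivative u t * - (c * \<sigma> * \<alpha>) + - (c * \<sigma> * \<beta> * \<sigma>))
        (at t within {a..b})" if t: "t \<in> {a..b} - N" for t
    proof -
      have "- (c * \<sigma>) * (\<alpha> * u t + \<beta> * v t) = u t * - (c * \<sigma> * \<alpha>) + - (c * \<sigma> * \<beta> * \<sigma>)"
        using ctrl[OF t] by (simp add: algebra_simps)
      then show ?thesis
        using DERIV_cmult[OF dh[OF t], of "- (c * \<sigma>)"] by simp
    qed
  qed (use lipf N ctrl in auto)
  show ?thesis
    by (rule zeros_finite_or_interval)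
qed

lemma extremal_zeros_finite_frontier:
  fixes f g h u v :: "real \<Rightarrow> real"
  assumes T: "0 < T"
    and lip: "\<exists>C. C-lipschitz_on {0..T} f" "\<exists>C. C-lipschitz_on {0..T} g" "\<exists>C. C-lipschitz_on {0..T} h"
    and N: "negligible N"
    and uv: "\<And>t. t \<in> {0..T} - N \<Longrightarrow> \<bar>u t\<bar> \<le> 1 \<and> \<bar>v t\<bar> \<le> 1"
    and max: "\<And>t. t \<in> {0..T} - N \<Longrightarrow> u t * f t + v t * g t = \<bar>f t\<bar> + \<bar>g t\<bar>"
    and df: "\<And>t. t \<in> {0..T} - N \<Longrightarrow> (f has_real_derivative - v t * h t) (at t within {0..T})"
    and dg: "\<And>t. t \<in> {0..T} - N \<Longrightarrow> (g has_real_derivative u t * h t) (at t within {0..T})"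
    and dh: "\<And>t. t \<in> {0..T} - N \<Longrightarrow>
      (h has_real_derivative u t * \<alpha> + v t * \<beta>) (at t within {0..T})"
    and nz: "\<And>t. t \<in> {0..T} \<Longrightarrow> f t \<noteq> 0 \<or> g t \<noteq> 0"
  shows "finite (frontier {t \<in> {0..T}. f t * g t = 0})"
proof (rule finite_frontier_if_locally_finite_or_interval)
  let ?Z = "{t \<in> {0..T}. f t * g t = 0}"
  have cont: "continuous_on {0..T} f" "continuous_on {0..T} g"
    by (rule exE[OF lip(1)], erule lipschitz_on_continuous_on)
      (rule exE[OF lip(2)], erule lipschitz_on_continuous_on)
  have "closed ?Z"
    by (intro continuous_closed_preimage_constant continuous_intros cont closed_atLeastAtMost)
  moreover have "bounded ?Z"
    by (rule bounded_subset[of "{0..T}"]) auto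
  ultimately show "compact ?Z"
    by (simp add: compact_eq_bounded_closed)
  fix t assume "t \<in> ?Z"
  then have t: "t \<in> {0..T}" and ft: "f t * g t = 0"
    by auto
  have keep: "\<exists>\<delta>>0. \<forall>s\<in>{max 0 (t - \<delta>)..min T (t + \<delta>)}. k s \<noteq> 0"
    if k: "continuous_on {0..T} k" "k t \<noteq> 0" for k :: "real \<Rightarrow> real"
  proof -
    have "\<forall>\<^sub>F s in at t within {0..T}. k s \<noteq> 0"
      using k t by (intro tendsto_imp_eventually_ne[of k "k t"]) (auto simp: continuous_on)
    then obtain d where "0 < d" "\<And>s. s \<in> {0..T} \<Longrightarrow> s \<noteq> t \<Longrightarrow> dist s t < d \<Longrightarrow> k s \<noteq> 0"
      unfolding eventually_at by blast
    then show ?thesis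
      using k(2) by (intro exI[of _ "d / 2"]) (force simp: dist_real_def)
  qed
  have sub: "{max 0 (t - \<delta>)..min T (t + \<delta>)} \<subseteq> {0..T}" for \<delta>
    by auto
  note loc = DERIV_subset[OF _ sub] and loclip = lipschitz_on_subset[OF _ sub]
  have cb: "?Z \<inter> cball t \<delta> = {s \<in> {max 0 (t - \<delta>)..min T (t + \<delta>)}. f s * g s = 0}" for \<delta>
    by (auto simp: dist_real_def)
  show "\<exists>\<delta>>0. finite (?Z \<inter> cball t \<delta>) \<or> is_interval (?Z \<inter> cball t \<delta>)"
  proof (cases "g t = 0")
    case False
    then obtain \<delta> where \<delta>: "0 < \<delta>" "\<And>s. s \<in> {max 0 (t - \<delta>)..min T (t + \<delta>)} \<Longrightarrow> g s \<noteq> 0"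
      using keep[OF cont(2)] by blast
    let ?a = "max 0 (t - \<delta>)" and ?b = "min T (t + \<delta>)"
    have "finite {s \<in> {?a..?b}. f s = 0} \<or> is_interval {s \<in> {?a..?b}. f s = 0}"
    proof (rule component_zeros_finite_or_interval[where g = g and h = h and u = u and v = v
          and c = "-1" and \<alpha> = \<alpha> and \<beta> = \<beta>, OF _ _ continuous_on_subset[OF cont(2) sub] \<delta>(2) N])
      show "\<exists>C. C-lipschitz_on {?a..?b} f" "\<exists>C. C-lipschitz_on {?a..?b} h"
        by (rule exE[OF lip(1)], rule exI, erule loclip) (rule exE[OF lip(3)], rule exI, erule loclip)
      fix s assume "s \<in> {?a..?b} - N"
      then have s: "s \<in> {0..T} - N"
        using subsetD[OF sub, of s] by blast
      show "\<bar>u s\<bar> \<le> 1 \<and> \<bar>v s\<bar> \<le> 1" "u s * f s + v s * g s = \<bar>f s\<bar> + \<bar>g s\<bar>"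
        using uv[OF s] max[OF s] by auto
      show "(f has_real_derivative - 1 * v s * h s) (at s within {?a..?b})"
        "(h has_real_derivative \<alpha> * u s + \<beta> * v s) (at s within {?a..?b})"
        using loc[OF df[OF s]] loc[OF dh[OF s]] by (auto simp: mult.commute)
    qed
    moreover have "?Z \<inter> cball t \<delta> = {s \<in> {?a..?b}. f s = 0}"
      unfolding cb using \<delta>(2) by auto
    ultimately show ?thesis
      using \<delta>(1) by (intro exI[of _ \<delta>]) simp
  next
    case True
    with nz[OF t] obtain \<delta> where \<delta>: "0 < \<delta>" "\<And>s. s \<in> {max 0 (t - \<delta>)..min T (t + \<delta>)} \<Longrightarrow> f s \<noteq> 0"
      using keep[OF cont(1)] by blast
    let ?a = "max 0 (t - \<delta>)" and ?b = "min T (t + \<delta>)"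
    have "finite {s \<in> {?a..?b}. g s = 0} \<or> is_interval {s \<in> {?a..?b}. g s = 0}"
    proof (rule component_zeros_finite_or_interval[where g = f and h = h and u = v and v = u
          and c = 1 and \<alpha> = \<beta> and \<beta> = \<alpha>, OF _ _ continuous_on_subset[OF cont(1) sub] \<delta>(2) N])
      show "\<exists>C. C-lipschitz_on {?a..?b} g" "\<exists>C. C-lipschitz_on {?a..?b} h"
        by (rule exE[OF lip(2)], rule exI, erule loclip) (rule exE[OF lip(3)], rule exI, erule loclip)
      fix s assume "s \<in> {?a..?b} - N"
      then have s: "s \<in> {0..T} - N"
        using subsetD[OF sub, of s] by blast
      show "\<bar>v s\<bar> \<le> 1 \<and> \<bar>u s\<bar> \<le> 1" "v s * g s + u s * f s = \<bar>g s\<bar> + \<bar>f s\<bar>"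
        using uv[OF s] max[OF s] by auto
      show "(g has_real_derivative 1 * u s * h s) (at s within {?a..?b})"
        "(h has_real_derivative \<beta> * v s + \<alpha> * u s) (at s within {?a..?b})"
        using loc[OF dg[OF s]] loc[OF dh[OF s]] by (auto simp: mult.commute add.commute)
    qed
    moreover have "?Z \<inter> cball t \<delta> = {s \<in> {?a..?b}. g s = 0}"
      unfolding cb using \<delta>(2) by auto
    ultimately show ?thesis
      using \<delta>(1) by (intro exI[of _ \<delta>]) simp
  qed
qed

section \<open>The extremal as a system of Lipschitz functions\<close>

lemma AE_lebesgue_on_imp_negligible:
  assumes S: "S \<in> sets lebesgue" and "AE t in lebesgue_on S. P t"
  shows "\<exists>N. negligible N \<and> (\<forall>t \<in> S - N. P t)"
proof -
  obtain N where "\<And>t. t \<in> space (lebesgue_on S) - N \<Longrightarrow> P t" "N \<in> null_sets (lebesgue_on S)"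
    using AE_E3[OF assms(2)] by blast
  then show ?thesis
    using S by (intro exI[of _ N]) (auto simp: negligible_iff_null_sets null_sets_restrict_space)
qed

lemma constant_off_negligible_Icc:
  fixes f :: "real \<Rightarrow> real"
  assumes "a < b" and cont: "continuous_on {a..b} f" and N: "negligible N"
    and eq: "\<And>t. t \<in> {a..b} - N \<Longrightarrow> f t = c" and t: "t \<in> {a..b}"
  shows "f t = c"
proof -
  let ?C = "{t \<in> {a..b}. f t = c}"
  have cl: "closed ?C"
    by (intro continuous_closed_preimage_constant cont) auto
  have "{t \<in> space lebesgue. \<not> (t \<in> {a<..<b} \<longrightarrow> t \<in> ?C)} \<subseteq> N"
  proof
    fix s assume "s \<in> {t \<in> space lebesgue. \<not> (t \<in> {a<..<b} \<longrightarrow> t \<in> ?C)}"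
    then show "s \<in> N"
      using eq[of s] by (cases "s \<in> N") auto
  qed
  with N have "AE t \<in> {a<..<b} in lebesgue. t \<in> ?C"
    unfolding negligible_iff_null_sets by (rule AE_I')
  then have "{a<..<b} \<subseteq> ?C"
    using mem_closed_if_AE_lebesgue_open[OF open_greaterThanLessThan cl] by blast
  then have "closure {a<..<b} \<subseteq> ?C"
    using cl by (rule closure_minimal)
  then show ?thesis
    using t \<open>a < b\<close> by (auto simp: closure_greaterThanLessThan)
qed

lemma lipschitz_pair_field:
  fixes \<xi> :: "real \<Rightarrow> cotangent"
  assumes S: "compact S" and \<xi>: "L-lipschitz_on S \<xi>"
    and X: "\<exists>C. C-lipschitz_on S (\<lambda>t. X (fst (\<xi> t)))"
  shows "\<exists>C. C-lipschitz_on S (\<lambda>t. pair_field X (\<xi> t))"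
proof -
  have "L-lipschitz_on S (\<lambda>t. snd (\<xi> t))"
  proof (rule lipschitz_onI)
    show "dist (snd (\<xi> s)) (snd (\<xi> t)) \<le> L * dist s t" if "s \<in> S" "t \<in> S" for s t
      using dist_snd_le lipschitz_onD[OF \<xi> that] by (rule order_trans)
  qed (rule lipschitz_on_nonneg[OF \<xi>])
  then show ?thesis
    unfolding pair_field_def
    by (intro bounded_bilinear.lipschitz_on_prod[OF bounded_bilinear_blinfun_apply S _ X] exI)
qed

text \<open>
  The frame is polynomial, so along the bounded curve its coefficients are Lipschitz; pairing them
  with the Lipschitz covector is again a product of Lipschitz functions.
\<close>
lemma lipschitz_frame:
  fixes \<xi> :: "real \<Rightarrow> cotangent"
  assumes S: "compact S" and \<xi>: "L-lipschitz_on S \<xi>"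
  shows "\<exists>C. C-lipschitz_on S (\<lambda>t. h1 (\<xi> t))" "\<exists>C. C-lipschitz_on S (\<lambda>t. h2 (\<xi> t))"
    "\<exists>C. C-lipschitz_on S (\<lambda>t. h3 (\<xi> t))" "\<exists>C. C-lipschitz_on S (\<lambda>t. h4 (\<xi> t))"
    "\<exists>C. C-lipschitz_on S (\<lambda>t. h5 (\<xi> t))"
proof -
  have coord: "\<exists>C. C-lipschitz_on S (\<lambda>t. fst (\<xi> t) $ i)" for i
  proof -
    have "L-lipschitz_on S (\<lambda>t. fst (\<xi> t) $ i)"
    proof (rule lipschitz_onI)
      show "dist (fst (\<xi> s) $ i) (fst (\<xi> t) $ i) \<le> L * dist s t" if "s \<in> S" "t \<in> S" for s t
        using dist_vec_nth_le dist_fst_le lipschitz_onD[OF \<xi> that] by (meson order_trans)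
    qed (rule lipschitz_on_nonneg[OF \<xi>])
    then show ?thesis ..
  qed
  have const: "\<exists>C. C-lipschitz_on S (\<lambda>t. k)" for k :: "'b::metric_space"
    by (rule exI, rule lipschitz_on_constant)
  have add: "\<exists>C. C-lipschitz_on S (\<lambda>t. F t + G t)"
    if "\<exists>C. C-lipschitz_on S F" "\<exists>C. C-lipschitz_on S G" for F G :: "real \<Rightarrow> 'c::real_normed_vector"
    using that by (elim exE) (rule exI, rule lipschitz_on_add)
  have diff: "\<exists>C. C-lipschitz_on S (\<lambda>t. F t - G t)"
    if "\<exists>C. C-lipschitz_on S F" "\<exists>C. C-lipschitz_on S G" for F G :: "real \<Rightarrow> 'd::real_normed_vector"
    using that by (elim exE) (rule exI, rule lipschitz_on_diff)
  note scaleR = bounded_bilinear.lipschitz_on_prod[OF bounded_bilinear_scaleR S]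
    and mult = bounded_bilinear.lipschitz_on_prod[OF bounded_bilinear_mult S]
  note rules = lipschitz_pair_field[OF S \<xi>] coord const add diff scaleR mult
  show "\<exists>C. C-lipschitz_on S (\<lambda>t. h1 (\<xi> t))"
    unfolding h1_def X1_def power2_eq_square divide_inverse by (intro rules)
  show "\<exists>C. C-lipschitz_on S (\<lambda>t. h2 (\<xi> t))"
    unfolding h2_def X2_def power2_eq_square divide_inverse by (intro rules)
  show "\<exists>C. C-lipschitz_on S (\<lambda>t. h3 (\<xi> t))"
    unfolding h3_def X3_def by (intro rules)
  show "\<exists>C. C-lipschitz_on S (\<lambda>t. h4 (\<xi> t))"
    unfolding h4_def X4_def by (intro rules)
  show "\<exists>C. C-lipschitz_on S (\<lambda>t. h5 (\<xi> t))"
    unfolding h5_def X5_def by (intro rules)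
qed

section \<open>Structure of the zero set along an extremal\<close>

theorem theorem7:
  fixes T :: real
    and q :: "real \<Rightarrow> real ^ 5"
    and u1 u2 :: "real \<Rightarrow> real"
    and \<xi> :: "real \<Rightarrow> cotangent"
  assumes "normal_extremal T q u1 u2 \<xi>"
  shows "\<exists>(n::nat) (\<tau>::nat \<Rightarrow> real).
    (\<forall>i\<in>{1..n}. 0 \<le> \<tau> i \<and> \<tau> i \<le> T) \<and>
    strict_mono_on {1..n} \<tau> \<and>
    (\<forall>i\<in>{1..n}. h1 (\<xi> (\<tau> i)) * h2 (\<xi> (\<tau> i)) = 0) \<and>
    (\<forall>i\<in>{1..<n}.
       (\<forall>t\<in>{\<tau> i<..<\<tau> (i + 1)}. h1 (\<xi> t) * h2 (\<xi> t) \<noteq> 0) \<or>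
       ((\<forall>t\<in>{\<tau> i..\<tau> (i + 1)}. h1 (\<xi> t) = 0) \<and> (\<forall>t\<in>{\<tau> i<..<\<tau> (i + 1)}. h2 (\<xi> t) \<noteq> 0)) \<or>
       ((\<forall>t\<in>{\<tau> i..\<tau> (i + 1)}. h2 (\<xi> t) = 0) \<and> (\<forall>t\<in>{\<tau> i<..<\<tau> (i + 1)}. h1 (\<xi> t) \<noteq> 0))) \<and>
    (\<forall>t\<in>{0..T}. (\<forall>i\<in>{1..n}. t < \<tau> i) \<or> (\<forall>i\<in>{1..n}. \<tau> i < t)
       \<longrightarrow> h1 (\<xi> t) * h2 (\<xi> t) \<noteq> 0)"
proof -
  let ?I = "{0..T}"
  let ?f = "\<lambda>t. h1 (\<xi> t)" and ?g = "\<lambda>t. h2 (\<xi> t)" and ?h = "\<lambda>t. h3 (\<xi> t)"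
  have T: "0 < T" and u_le: "\<And>t. t \<in> ?I \<Longrightarrow> \<bar>u1 t\<bar> \<le> 1 \<and> \<bar>u2 t\<bar> \<le> 1"
    using assms by (auto simp: normal_extremal_def trajectory_def)
  obtain L where L: "L-lipschitz_on ?I \<xi>"
    using assms by (auto simp: normal_extremal_def)
  let ?P = "\<lambda>H t. (?f has_real_derivative (- u2 t * ?h t)) (at t within ?I) \<and>
        (?g has_real_derivative (u1 t * ?h t)) (at t within ?I) \<and>
        (?h has_real_derivative (u1 t * h4 (\<xi> t) + u2 t * h5 (\<xi> t))) (at t within ?I) \<and>
        ((\<lambda>s. h4 (\<xi> s)) has_real_derivative 0) (at t within ?I) \<and>
        ((\<lambda>s. h5 (\<xi> s)) has_real_derivative 0) (at t within ?I) \<and>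
        u1 t * ?f t + u2 t * ?g t = \<bar>?f t\<bar> + \<bar>?g t\<bar> \<and> \<bar>?f t\<bar> + \<bar>?g t\<bar> = H"
  obtain H where "0 < H" and ae: "AE t in lebesgue_on ?I. ?P H t"
    using assms unfolding normal_extremal_def by blast
  have "\<exists>N. negligible N \<and> (\<forall>t \<in> ?I - N. ?P H t)"
    by (rule AE_lebesgue_on_imp_negligible[OF _ ae]) simp
  then obtain N where N: "negligible N" and "\<forall>t \<in> ?I - N. ?P H t"
    by (elim exE conjE)
  note ext = bspec[OF this(2)]
  note lip = lipschitz_frame[OF compact_Icc L]
  have cont: "continuous_on ?I ?f" "continuous_on ?I ?g"
    by (rule exE[OF lip(1)], erule lipschitz_on_continuous_on)
      (rule exE[OF lip(2)], erule lipschitz_on_continuous_on)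
  \<comment> \<open>The Casimirs are constant, which makes \<open>p\<close> and \<open>r\<close> of the reduced dynamics constants.\<close>
  have h4: "h4 (\<xi> t) = h4 (\<xi> 0)" and h5: "h5 (\<xi> t) = h5 (\<xi> 0)" if "t \<in> ?I" for t
  proof -
    obtain C where C: "C-lipschitz_on ?I (\<lambda>t. h4 (\<xi> t))"
      using lip(4) ..
    show "h4 (\<xi> t) = h4 (\<xi> 0)"
      by (rule lipschitz_zero_derivative_constant[OF C N _ that]) (use ext T in auto)
    obtain D where D: "D-lipschitz_on ?I (\<lambda>t. h5 (\<xi> t))"
      using lip(5) ..
    show "h5 (\<xi> t) = h5 (\<xi> 0)"
      by (rule lipschitz_zero_derivative_constant[OF D N _ that]) (use ext T in auto)
  qed
  have H: "\<bar>?f t\<bar> + \<bar>?g t\<bar> = H" if t: "t \<in> ?I" for t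
    by (rule constant_off_negligible_Icc[OF T _ N _ t])
      (use ext in \<open>auto intro!: continuous_intros cont\<close>)
  then have nz: "?f t \<noteq> 0 \<or> ?g t \<noteq> 0" if "t \<in> ?I" for t
    using \<open>0 < H\<close> that by fastforce
  define Z where "Z = {t \<in> ?I. ?f t * ?g t = 0}"
  have frontier: "finite (frontier Z)"
    unfolding Z_def
  proof (rule extremal_zeros_finite_frontier[OF T lip(1-3) N _ _ _ _ _ nz,
        where u = u1 and v = u2 and \<alpha> = "h4 (\<xi> 0)" and \<beta> = "h5 (\<xi> 0)"])
    fix t assume t: "t \<in> ?I - N"
    then have "t \<in> ?I"
      by blast
    from ext[OF t] u_le[OF this] h4[OF this] h5[OF this]
    show "\<bar>u1 t\<bar> \<le> 1 \<and> \<bar>u2 t\<bar> \<le> 1" "u1 t * ?f t + u2 t * ?g t = \<bar>?f t\<bar> + \<bar>?g t\<bar>"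
      "(?f has_real_derivative - u2 t * ?h t) (at t within ?I)"
      "(?g has_real_derivative u1 t * ?h t) (at t within ?I)"
      "(?h has_real_derivative u1 t * h4 (\<xi> 0) + u2 t * h5 (\<xi> 0)) (at t within ?I)"
      by simp_all
  qed
  have "compact Z"
    unfolding Z_def compact_eq_bounded_closed
    by (intro conjI bounded_subset[OF bounded_closed_interval[of 0 T]]
        continuous_closed_preimage_constant continuous_intros cont closed_atLeastAtMost) auto
  from finite_frontier_enumeration[OF this frontier]
  obtain n :: nat and \<tau> :: "nat \<Rightarrow> real" where \<tau>: "\<forall>i\<in>{1..n}. \<tau> i \<in> Z" "strict_mono_on {1..n} \<tau>"
    and alt: "\<forall>i\<in>{1..<n}. {\<tau> i<..<\<tau> (i + 1)} \<inter> Z = {} \<or> {\<tau> i..\<tau> (i + 1)} \<subseteq> Z"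
    and enclosed: "\<forall>t\<in>Z. \<exists>i\<in>{1..n}. \<exists>j\<in>{1..n}. \<tau> i \<le> t \<and> t \<le> \<tau> j"
    by (elim exE conjE)
  have split: "(\<forall>t\<in>{c..d}. ?f t = 0) \<or> (\<forall>t\<in>{c..d}. ?g t = 0)" if cd: "{c..d} \<subseteq> Z" for c d
  proof -
    have I: "{c..d} \<subseteq> ?I"
      using cd by (auto simp: Z_def)
    let ?F = "{t \<in> {c..d}. ?f t = 0}" and ?G = "{t \<in> {c..d}. ?g t = 0}"
    have "closed ?F" "closed ?G"
      by (intro continuous_closed_preimage_constant continuous_on_subset[OF cont(1) I]
          continuous_on_subset[OF cont(2) I] closed_atLeastAtMost)+
    moreover have "{c..d} \<subseteq> ?F \<union> ?G"
      using cd by (auto simp: Z_def)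
    moreover have "?F \<inter> ?G \<inter> {c..d} = {}"
      using nz I by blast
    ultimately have "?F \<inter> {c..d} = {} \<or> ?G \<inter> {c..d} = {}"
      by (intro connected_closedD[OF connected_Icc])
    then show ?thesis
      using cd by (auto simp: Z_def)
  qed
  have pieces: "(\<forall>t\<in>{\<tau> i<..<\<tau> (i + 1)}. ?f t * ?g t \<noteq> 0) \<or>
       ((\<forall>t\<in>{\<tau> i..\<tau> (i + 1)}. ?f t = 0) \<and> (\<forall>t\<in>{\<tau> i<..<\<tau> (i + 1)}. ?g t \<noteq> 0)) \<or>
       ((\<forall>t\<in>{\<tau> i..\<tau> (i + 1)}. ?g t = 0) \<and> (\<forall>t\<in>{\<tau> i<..<\<tau> (i + 1)}. ?f t \<noteq> 0))"
    if i: "i \<in> {1..<n}" for i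
  proof -
    have "\<tau> i \<in> ?I" "\<tau> (i + 1) \<in> ?I"
      using bspec[OF \<tau>(1), of i] bspec[OF \<tau>(1), of "i + 1"] i by (auto simp: Z_def)
    then have I: "{\<tau> i..\<tau> (i + 1)} \<subseteq> ?I"
      by auto
    from bspec[OF alt i] show ?thesis
    proof
      assume "{\<tau> i<..<\<tau> (i + 1)} \<inter> Z = {}"
      then have "\<forall>t\<in>{\<tau> i<..<\<tau> (i + 1)}. ?f t * ?g t \<noteq> 0"
        using I by (force simp: Z_def)
      then show ?thesis ..
    next
      assume "{\<tau> i..\<tau> (i + 1)} \<subseteq> Z"
      from split[OF this] have "(\<forall>t\<in>{\<tau> i..\<tau> (i + 1)}. ?f t = 0 \<and> ?g t \<noteq> 0) \<or>
          (\<forall>t\<in>{\<tau> i..\<tau> (i + 1)}. ?g t = 0 \<and> ?f t \<noteq> 0)"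
        using nz I by blast
      moreover have "{\<tau> i<..<\<tau> (i + 1)} \<subseteq> {\<tau> i..\<tau> (i + 1)}"
        by auto
      ultimately show ?thesis
        by blast
    qed
  qed
  have outside: "?f t * ?g t \<noteq> 0"
    if "t \<in> ?I" "(\<forall>i\<in>{1..n}. t < \<tau> i) \<or> (\<forall>i\<in>{1..n}. \<tau> i < t)" for t
    using bspec[OF enclosed, of t] that by (force simp: Z_def)
  show ?thesis
    by (intro exI[of _ n] exI[of _ \<tau>] conjI ballI impI)
      (use \<tau> pieces outside in \<open>auto simp: Z_def\<close>)
qed

end
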